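(* Let $\beta\in(0,1)$, let $U(t)$ be a $\beta$-stable subordinator and let $E_t$ be the associated inverse stable subordinator. Let $T>0$ and let $x, K:\Omega\times[0,T]\to\mathbb{R}_+$ be $\mathcal{F}_t$-measurable functions which are integrable with respect to $E_t$. Let $u_0\ge 0$ be a constant. Then the inequality $$x(t)\le u_0+\int_0^t K(s)x(s)\,\mathrm{d}E_s,\qquad 0\le t\le T,$$ implies that almost surely $$x(t)\le u_0\exp\Big(\int_0^t K(s)\,\mathrm{d}E_s\Big),\qquad 0\le t\le T.$$
   Context: A $\beta$-stable subordinator $U(t)$ with index $\beta\in(0,1)$ is a strictly increasing $\beta$-stable L\'evy process with Laplace transform $\mathbb{E}[\exp(-sU(t))]=\exp(-ts^\beta)$. Its inverse is $E_t=\inf\{s>0: U(s)>t\}$; since $U$ is strictly increasing, $t\mapsto E_t$ is continuous and nondecreasing. $B_t$ is a standard Brownian motion, and $$\mathcal{F}_t=\bigcap_{u>t}\big\{\sigma(B_s:0\le s\le u)\vee\sigma(E_s:s\ge 0)\big\},$$ where $\sigma_1\vee\sigma_2$ is the $\sigma$-field generated by $\sigma_1\cup\sigma_2$. That a function is $\mathcal{F}_t$-measurable means that it is measurable with respect to this filtration as a process. Integrals $\int_0^t\cdot\,\mathrm{d}E_s$ are pathwise Lebesgue--Stieltjes integrals, and all integrals appearing in the statement (including the one in the hypothesis inequality) are understood to be well defined and finite. *)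

theory Defs
  imports "HOL-Probability.Probability"
begin

text \<open>
  Processes are functions of time and outcome; only the values at times \<open>t \<ge> 0\<close> matter.
  All path properties are required almost surely.
\<close>

definition independent_increments :: "'a measure \<Rightarrow> (real \<Rightarrow> 'a \<Rightarrow> real) \<Rightarrow> bool" where
  "independent_increments M X \<longleftrightarrow>
     (\<forall>(n::nat) (\<tau>::nat \<Rightarrow> real). 0 \<le> \<tau> 0 \<and> (\<forall>i<n. \<tau> i \<le> \<tau> (Suc i)) \<longrightarrow>
        prob_space.indep_vars M (\<lambda>_. borel) (\<lambda>i \<omega>. X (\<tau> (Suc i)) \<omega> - X (\<tau> i) \<omega>) {..<n})"

definition stationary_increments :: "'a measure \<Rightarrow> (real \<Rightarrow> 'a \<Rightarrow> real) \<Rightarrow> bool" where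
  "stationary_increments M X \<longleftrightarrow>
     (\<forall>s\<ge>0. \<forall>t\<ge>0. distr M borel (\<lambda>\<omega>. X (s + t) \<omega> - X s \<omega>)
                     = distr M borel (\<lambda>\<omega>. X t \<omega> - X 0 \<omega>))"

definition stochastically_continuous :: "'a measure \<Rightarrow> (real \<Rightarrow> 'a \<Rightarrow> real) \<Rightarrow> bool" where
  "stochastically_continuous M X \<longleftrightarrow>
     (\<forall>t\<ge>0. \<forall>\<epsilon>>0.
        ((\<lambda>s. measure M {\<omega> \<in> space M. \<bar>X s \<omega> - X t \<omega>\<bar> > \<epsilon>}) \<longlongrightarrow> 0) (at t within {0..}))"

definition cadlag :: "(real \<Rightarrow> real) \<Rightarrow> bool" where
  "cadlag f \<longleftrightarrow>
     (\<forall>t\<ge>0. (f \<longlongrightarrow> f t) (at_right t)) \<and> (\<forall>t>0. \<exists>l. (f \<longlongrightarrow> l) (at_left t))"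

definition levy_process :: "'a measure \<Rightarrow> (real \<Rightarrow> 'a \<Rightarrow> real) \<Rightarrow> bool" where
  "levy_process M X \<longleftrightarrow>
     (\<forall>t\<ge>0. X t \<in> borel_measurable M) \<and>
     (AE \<omega> in M. X 0 \<omega> = 0) \<and>
     independent_increments M X \<and>
     stationary_increments M X \<and>
     stochastically_continuous M X \<and>
     (AE \<omega> in M. cadlag (\<lambda>t. X t \<omega>))"

text \<open>Strict stability: \<open>X (c t)\<close> and \<open>c\<^bsup>1/\<beta>\<^esup> X t\<close> have the same law.\<close>

definition stable_levy_process :: "'a measure \<Rightarrow> real \<Rightarrow> (real \<Rightarrow> 'a \<Rightarrow> real) \<Rightarrow> bool" where
  "stable_levy_process M \<beta> X \<longleftrightarrow>
     levy_process M X \<and>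
     (\<forall>c>0. \<forall>t\<ge>0. distr M borel (X (c * t)) = distr M borel (\<lambda>\<omega>. c powr (1 / \<beta>) * X t \<omega>))"

definition stable_subordinator :: "'a measure \<Rightarrow> real \<Rightarrow> (real \<Rightarrow> 'a \<Rightarrow> real) \<Rightarrow> bool" where
  "stable_subordinator M \<beta> U \<longleftrightarrow>
     stable_levy_process M \<beta> U \<and>
     (AE \<omega> in M. strict_mono_on {0..} (\<lambda>t. U t \<omega>)) \<and>
     (\<forall>t\<ge>0. \<forall>s\<ge>0. integrable M (\<lambda>\<omega>. exp (- s * U t \<omega>)) \<and>
        (\<integral>\<omega>. exp (- s * U t \<omega>) \<partial>M) = exp (- t * s powr \<beta>))"

text \<open>
  Almost surely \<open>U\<close> is unbounded, so the infimum is over a nonempty set bounded below,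
  and it vanishes for \<open>t < 0\<close>.
\<close>

definition inverse_subordinator :: "(real \<Rightarrow> 'a \<Rightarrow> real) \<Rightarrow> real \<Rightarrow> 'a \<Rightarrow> real" where
  "inverse_subordinator U t \<omega> = Inf {s. 0 < s \<and> U s \<omega> > t}"

definition standard_brownian_motion :: "'a measure \<Rightarrow> (real \<Rightarrow> 'a \<Rightarrow> real) \<Rightarrow> bool" where
  "standard_brownian_motion M B \<longleftrightarrow>
     (\<forall>t\<ge>0. B t \<in> borel_measurable M) \<and>
     (AE \<omega> in M. B 0 \<omega> = 0) \<and>
     independent_increments M B \<and>
     (\<forall>s\<ge>0. \<forall>t>s. distributed M lborel (\<lambda>\<omega>. B t \<omega> - B s \<omega>) (normal_density 0 (sqrt (t - s)))) \<and>
     (AE \<omega> in M. continuous_on {0..} (\<lambda>t. B t \<omega>))"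

definition joint_sigma ::
  "'a set \<Rightarrow> (real \<Rightarrow> 'a \<Rightarrow> real) \<Rightarrow> (real \<Rightarrow> 'a \<Rightarrow> real) \<Rightarrow> real \<Rightarrow> 'a measure" where
  "joint_sigma \<Omega> B E u = sigma \<Omega>
     ({B s -` A \<inter> \<Omega> | s A. 0 \<le> s \<and> s \<le> u \<and> A \<in> sets borel} \<union>
      {E s -` A \<inter> \<Omega> | s A. 0 \<le> s \<and> A \<in> sets borel})"

definition time_changed_filtration ::
  "'a set \<Rightarrow> (real \<Rightarrow> 'a \<Rightarrow> real) \<Rightarrow> (real \<Rightarrow> 'a \<Rightarrow> real) \<Rightarrow> real \<Rightarrow> 'a measure" where
  "time_changed_filtration \<Omega> B E t = sigma \<Omega> (\<Inter>u\<in>{t<..}. sets (joint_sigma \<Omega> B E u))"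

lemma space_joint_sigma [simp]: "space (joint_sigma \<Omega> B E u) = \<Omega>"
  by (auto simp: joint_sigma_def space_measure_of_conv)

lemma space_time_changed_filtration [simp]: "space (time_changed_filtration \<Omega> B E t) = \<Omega>"
  by (simp add: time_changed_filtration_def space_measure_of_conv)

text \<open>The outer \<open>sigma\<close> adds no sets: it only turns the intersection into a measure space.\<close>

lemma sets_time_changed_filtration:
  "sets (time_changed_filtration \<Omega> B E t) = (\<Inter>u\<in>{t<..}. sets (joint_sigma \<Omega> B E u))"
proof -
  let ?S = "\<lambda>u. sets (joint_sigma \<Omega> B E u)"
  have sa: "sigma_algebra \<Omega> (?S u)" for u
    using sets.sigma_algebra_axioms[of "joint_sigma \<Omega> B E u"] by simp
  have sub: "?S u \<subseteq> Pow \<Omega>" for u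
    using sets.space_closed[of "joint_sigma \<Omega> B E u"] by simp
  have ne: "t + 1 \<in> {t<..}" by simp
  have subI: "(\<Inter>u\<in>{t<..}. ?S u) \<subseteq> Pow \<Omega>"
    using sub ne by blast
  have "sigma_sets \<Omega> (\<Inter>u\<in>{t<..}. ?S u) \<subseteq> ?S u" if "t < u" for u
    using sigma_algebra.sigma_sets_subset[OF sa, of "\<Inter>u\<in>{t<..}. ?S u" u] that by auto
  then have "sigma_sets \<Omega> (\<Inter>u\<in>{t<..}. ?S u) = (\<Inter>u\<in>{t<..}. ?S u)"
    by auto
  then show ?thesis
    using subI by (simp add: time_changed_filtration_def sets_measure_of)
qed

definition adapted_upto ::
  "(real \<Rightarrow> 'a measure) \<Rightarrow> real \<Rightarrow> (real \<Rightarrow> 'a \<Rightarrow> real) \<Rightarrow> bool" where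
  "adapted_upto F T X \<longleftrightarrow> (\<forall>t\<in>{0..T}. X t \<in> borel_measurable (F t))"

text \<open>
  The Lebesgue--Stieltjes measure of the path \<open>t \<mapsto> E t \<omega>\<close>. Integrals \<open>\<integral>\<^sub>0\<^sup>t\<close> are taken over
  \<open>{0<..t}\<close>; since the inverse subordinator has continuous paths, end points carry no mass.
\<close>

definition path_measure :: "(real \<Rightarrow> 'a \<Rightarrow> real) \<Rightarrow> 'a \<Rightarrow> real measure" where
  "path_measure E \<omega> = interval_measure (\<lambda>t. E t \<omega>)"

end

theory Submission
  imports Defs
begin

text \<open>
  The statement is pathwise. For almost every outcome the path \<open>t \<mapsto> E t \<omega>\<close> is nondecreasing and
  continuous, so its Lebesgue--Stieltjes measure has no atoms, and the claim becomes Gronwall's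
  inequality for an atomless measure on the line (\<open>gronwall_atomless\<close>).

  Gronwall's inequality holds because the right-hand side
  \<open>w t = u0 + (\<integral>\<^sub>0\<^sup>t K x dE)\<close> dominates \<open>x\<close> and is nondecreasing, so with \<open>A t = (\<integral>\<^sub>0\<^sup>t K dE)\<close> one has
  \<open>w b - w a \<le> w b * (A b - A a)\<close> for \<open>a \<le> b\<close>. Absence of atoms makes \<open>A\<close> continuous, so \<open>[0, t]\<close>
  can be cut at points between which \<open>A\<close> grows by exactly \<open>A t / n\<close>. Each piece contributes a
  factor, \<open>(1 - A t / n) ^ n * w t \<le> w 0 = u0\<close>, and \<open>n \<longrightarrow> \<infinity>\<close> yields \<open>w t \<le> u0 * exp (A t)\<close>
  (\<open>gronwall_increments\<close>). An atom would be a piece that cannot be cut: with a single point of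
  mass \<open>m < 1\<close> and \<open>K = 1\<close>, the hypothesis still allows \<open>x = u0 / (1 - m)\<close> there, which exceeds
  \<open>u0 * exp m\<close> when \<open>u0\<close> and \<open>m\<close> are positive.

  The path of \<open>E\<close> is continuous because \<open>U\<close> is strictly increasing: \<open>E\<close> inverts \<open>U\<close> on the left,
  hence attains every value \<open>s \<ge> 0\<close>, and a monotone function without gaps in its range has no
  jumps (\<open>generalized_inverse_continuous\<close>). This needs the path of \<open>U\<close> to be unbounded, as
  otherwise the infimum defining \<open>E\<close> is eventually taken over the empty set; unboundedness follows
  from the fact that the expectation of \<open>exp (- U n)\<close> is \<open>exp (- n)\<close>, which tends to zero
  (\<open>AE_unbounded_if_Laplace_tendsto_0\<close>).
\<close>

section \<open>Gronwall's inequality for an atomless measure\<close>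

text \<open>
  A piece of \<open>A\<close>-length \<open>\<delta> \<le> 1\<close> costs a factor \<open>1 - \<delta>\<close> because the hypothesis involves \<open>w\<close> at the
  right end point. The intermediate value theorem provides \<open>n\<close> pieces with \<open>\<delta> = (A b - A a) / n\<close>,
  and \<open>(1 - (A b - A a) / n) ^ n\<close> tends to \<open>exp (- (A b - A a))\<close>.
\<close>

lemma gronwall_increments:
  fixes A w :: "real \<Rightarrow> real"
  assumes ab: "a \<le> b" and cont: "continuous_on {a..b} A" and A: "A a \<le> A b"
    and incr: "\<And>c d. a \<le> c \<Longrightarrow> c \<le> d \<Longrightarrow> d \<le> b \<Longrightarrow> w d - w c \<le> w d * (A d - A c)"
  shows "w b \<le> w a * exp (A b - A a)"
proof -
  have steps: "(1 - \<delta>) ^ m * w c \<le> w a"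
    if \<delta>: "0 \<le> \<delta>" "\<delta> \<le> 1" and c: "c \<in> {a..b}" "A c = A a + real m * \<delta>" for \<delta> m c
    using c
  proof (induction m arbitrary: c)
    case 0
    then show ?case using incr[of a c] by auto
  next
    case (Suc m)
    have "continuous_on {a..c} A"
      using continuous_on_subset[OF cont] Suc.prems(1) by auto
    moreover have "A a \<le> A a + real m * \<delta>" "A a + real m * \<delta> \<le> A c" "a \<le> c"
      using Suc.prems \<delta> by (auto simp: algebra_simps)
    ultimately obtain c' where c': "a \<le> c'" "c' \<le> c" "A c' = A a + real m * \<delta>"
      using IVT'[of A a "A a + real m * \<delta>" c] by auto
    have "w c - w c' \<le> w c * \<delta>"
      using incr[of c' c] c' Suc.prems by (auto simp: algebra_simps)
    then have "(1 - \<delta>) * w c \<le> w c'"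
      by (simp add: algebra_simps)
    then have "(1 - \<delta>) ^ m * ((1 - \<delta>) * w c) \<le> (1 - \<delta>) ^ m * w c'"
      using \<delta> by (intro mult_left_mono) auto
    also have "\<dots> \<le> w a"
      using c' Suc.prems by (intro Suc.IH) auto
    finally show ?case by (simp add: mult_ac)
  qed
  define L where "L = A b - A a"
  have "(\<lambda>n. (1 + (- L) / real n) ^ n * w b) \<longlonglongrightarrow> exp (- L) * w b"
    by (intro tendsto_mult tendsto_exp_limit_sequentially tendsto_const)
  moreover have "\<forall>\<^sub>F n in sequentially. (1 + (- L) / real n) ^ n * w b \<le> w a"
  proof (rule eventually_sequentiallyI)
    fix n assume n: "nat \<lceil>L\<rceil> + 1 \<le> n"
    then have "L \<le> real n" "0 < n" by linarith+
    moreover have "0 \<le> L"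
      using A by (simp add: L_def)
    ultimately have "0 \<le> L / real n" "L / real n \<le> 1" "A b = A a + real n * (L / real n)"
      by (simp_all add: L_def)
    then have "(1 - L / real n) ^ n * w b \<le> w a"
      using ab by (intro steps) auto
    then show "(1 + (- L) / real n) ^ n * w b \<le> w a"
      by (simp only: minus_divide_left[symmetric] add_uminus_conv_diff)
  qed
  ultimately have "exp (- L) * w b \<le> w a"
    by (rule tendsto_upperbound) simp
  then show ?thesis
    by (simp add: L_def[symmetric] exp_minus field_simps)
qed

lemma set_integral_Ioc_diff:
  fixes f :: "real \<Rightarrow> real"
  assumes N: "sets N = sets borel" and f: "set_integrable N {0<..T} f"
    and "0 \<le> a" "a \<le> b" "b \<le> T"
  shows "(LINT s:{0<..b}|N. f s) - (LINT s:{0<..a}|N. f s) = (LINT s:{a<..b}|N. f s)"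
proof -
  have "{0<..b} = {0<..a} \<union> {a<..b}"
    using assms by auto
  moreover have "set_integrable N {0<..a} f" "set_integrable N {a<..b} f"
    by (rule set_integrable_subset[OF f]; use assms in auto)+
  ultimately show ?thesis
    by (simp add: set_integral_Un)
qed

text \<open>
  When \<open>u n \<longrightarrow> t\<close>, the indicators of \<open>{0<..u n}\<close> converge pointwise to that of \<open>{0<..t}\<close> except
  possibly at \<open>t\<close> itself, which is a null set.
\<close>

lemma indefinite_integral_continuous_atomless:
  fixes f :: "real \<Rightarrow> real"
  assumes N: "sets N = sets borel" and atomless: "\<And>t. emeasure N {t} = 0"
    and f: "set_integrable N {0<..T} f"
  shows "continuous_on {0..T} (\<lambda>t. LINT s:{0<..t}|N. f s)"
proof (rule continuous_on_sequentiallyI)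
  fix u :: "nat \<Rightarrow> real" and t
  assume u: "\<forall>n. u n \<in> {0..T}" and t: "t \<in> {0..T}" and lim: "u \<longlonglongrightarrow> t"
  have meas: "(\<lambda>s. indicator {0<..r} s *\<^sub>R f s) \<in> borel_measurable N" if "r \<in> {0..T}" for r
  proof -
    have "set_integrable N {0<..r} f"
      by (rule set_integrable_subset[OF f]) (use that N in auto)
    then show ?thesis
      unfolding set_integrable_def by (rule borel_measurable_integrable)
  qed
  have "AE s in N. s \<noteq> t"
    using AE_not_in[of "{t}" N] atomless[of t] N by (auto simp: null_sets_def)
  then have conv: "AE s in N. (\<lambda>n. indicator {0<..u n} s *\<^sub>R f s) \<longlonglongrightarrow> indicator {0<..t} s *\<^sub>R f s"
  proof eventually_elim
    case (elim s)
    have "\<forall>\<^sub>F n in sequentially. (s \<le> u n) = (s \<le> t)"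
    proof (cases "s < t")
      case True
      from order_tendstoD(1)[OF lim True] show ?thesis by eventually_elim (use True in auto)
    next
      case False
      then have "t < s" using elim by auto
      from order_tendstoD(2)[OF lim this] show ?thesis by eventually_elim (use \<open>t < s\<close> in auto)
    qed
    then have "\<forall>\<^sub>F n in sequentially. indicator {0<..u n} s *\<^sub>R f s = indicator {0<..t} s *\<^sub>R f s"
      by eventually_elim (auto simp: indicator_def)
    then show ?case by (rule tendsto_eventually)
  qed
  show "(\<lambda>n. LINT s:{0<..u n}|N. f s) \<longlonglongrightarrow> (LINT s:{0<..t}|N. f s)"
    unfolding set_lebesgue_integral_def
  proof (rule integral_dominated_convergence)
    show "integrable N (\<lambda>s. norm (indicator {0<..T} s *\<^sub>R f s))"
      using f unfolding set_integrable_def by (rule integrable_norm)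
    show "AE s in N. norm (indicator {0<..u n} s *\<^sub>R f s) \<le> norm (indicator {0<..T} s *\<^sub>R f s)" for n
      using u[rule_format, of n] by (intro AE_I2) (auto simp: indicator_def)
    show "AE s in N. (\<lambda>n. indicator {0<..u n} s *\<^sub>R f s) \<longlonglongrightarrow> indicator {0<..t} s *\<^sub>R f s"
      by (fact conv)
  qed (rule meas, use u t in blast)+
qed

text \<open>
  On \<open>{c<..d}\<close> the function \<open>x\<close> is at most the value at \<open>d\<close> of its nondecreasing majorant, which
  is what the comparison of increments asks for.
\<close>

lemma gronwall_atomless:
  fixes K x :: "real \<Rightarrow> real"
  assumes N: "sets N = sets borel" and atomless: "\<And>t. emeasure N {t} = 0"
    and K_nonneg: "\<And>s. s \<in> {0..T} \<Longrightarrow> 0 \<le> K s"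
    and x_nonneg: "\<And>s. s \<in> {0..T} \<Longrightarrow> 0 \<le> x s"
    and K: "set_integrable N {0<..T} K" and Kx: "set_integrable N {0<..T} (\<lambda>s. K s * x s)"
    and x_le: "\<And>t. t \<in> {0..T} \<Longrightarrow> x t \<le> u0 + (LINT s:{0<..t}|N. K s * x s)"
    and t: "t \<in> {0..T}"
  shows "x t \<le> u0 * exp (LINT s:{0<..t}|N. K s)"
proof -
  define w where "w = (\<lambda>t. u0 + (LINT s:{0<..t}|N. K s * x s))"
  define A where "A = (\<lambda>t. LINT s:{0<..t}|N. K s)"
  have w_diff: "w d - w c = (LINT s:{c<..d}|N. K s * x s)"
    and A_diff: "A d - A c = (LINT s:{c<..d}|N. K s)" if "0 \<le> c" "c \<le> d" "d \<le> T" for c d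
    using set_integral_Ioc_diff[OF N Kx that] set_integral_Ioc_diff[OF N K that]
    by (simp_all add: w_def A_def)
  have w_mono: "w c \<le> w d" if "0 \<le> c" "c \<le> d" "d \<le> T" for c d
  proof -
    have "0 \<le> (LINT s:{c<..d}|N. K s * x s)"
      using that K_nonneg x_nonneg unfolding set_lebesgue_integral_def
      by (intro integral_nonneg_AE AE_I2) (auto simp: indicator_def)
    then show ?thesis using w_diff[OF that] by simp
  qed
  have incr: "w d - w c \<le> w d * (A d - A c)" if cd: "0 \<le> c" "c \<le> d" "d \<le> T" for c d
  proof -
    have "(LINT s:{c<..d}|N. K s * x s) \<le> (LINT s:{c<..d}|N. w d * K s)"
    proof (rule set_integral_mono)
      show "set_integrable N {c<..d} (\<lambda>s. K s * x s)"
        by (rule set_integrable_subset[OF Kx]) (use cd N in auto)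
      show "set_integrable N {c<..d} (\<lambda>s. w d * K s)"
        by (rule set_integrable_mult_right, rule set_integrable_subset[OF K]) (use cd N in auto)
      fix s assume s: "s \<in> {c<..d}"
      then have "x s \<le> w d"
        using x_le[of s] w_mono[of s d] cd by (auto simp: w_def)
      moreover have "0 \<le> K s"
        using K_nonneg[of s] s cd by auto
      ultimately show "K s * x s \<le> w d * K s"
        using mult_left_mono[of "x s" "w d" "K s"] by (simp add: mult.commute)
    qed
    then show ?thesis using w_diff[OF cd] A_diff[OF cd] by simp
  qed
  have "0 \<le> A t"
    using t K_nonneg unfolding A_def set_lebesgue_integral_def
    by (intro integral_nonneg_AE AE_I2) (auto simp: indicator_def)
  moreover have "A 0 = 0" "w 0 = u0"
    by (simp_all add: A_def w_def set_lebesgue_integral_def)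
  moreover have "continuous_on {0..t} A"
    using continuous_on_subset[OF indefinite_integral_continuous_atomless[OF N atomless K]] t
    by (auto simp: A_def)
  ultimately have "w t \<le> u0 * exp (A t)"
    using gronwall_increments[of 0 t A w] incr t by auto
  then show ?thesis
    using x_le[OF t] by (simp add: w_def A_def)
qed

section \<open>Paths of the inverse subordinator\<close>

text \<open>
  Where \<open>exp (- Y n)\<close> stays above a fixed positive level for all \<open>n\<close>, Markov's inequality
  bounds the probability by a multiple of each of the expectations, which tend to zero.
\<close>

lemma (in prob_space) AE_unbounded_if_Laplace_tendsto_0:
  fixes Y :: "nat \<Rightarrow> 'a \<Rightarrow> real"
  assumes int: "\<And>n. integrable M (\<lambda>\<omega>. exp (- Y n \<omega>))"
    and lim: "(\<lambda>n. expectation (\<lambda>\<omega>. exp (- Y n \<omega>))) \<longlonglongrightarrow> 0"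
  shows "AE \<omega> in M. \<forall>c. \<exists>n. c < Y n \<omega>"
proof -
  have [measurable]: "(\<lambda>\<omega>. exp (- Y n \<omega>)) \<in> borel_measurable M" for n
    using int by (rule borel_measurable_integrable)
  have "AE \<omega> in M. \<exists>n. exp (- Y n \<omega>) < exp (- real c)" for c :: nat
  proof -
    let ?S = "{\<omega> \<in> space M. \<forall>n. exp (- real c) \<le> exp (- Y n \<omega>)}"
    have S: "?S \<in> sets M" by measurable
    have "prob ?S \<le> expectation (\<lambda>\<omega>. exp (- Y n \<omega>)) / exp (- real c)" for n
    proof -
      have "prob ?S \<le> prob {\<omega> \<in> space M. exp (- real c) \<le> exp (- Y n \<omega>)}"
        by (intro finite_measure_mono) (blast, measurable)
      also have "\<dots> \<le> expectation (\<lambda>\<omega>. exp (- Y n \<omega>)) / exp (- real c)"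
        by (rule integral_Markov_inequality_measure[where A="{}"]) (use int in auto)
      finally show ?thesis .
    qed
    moreover have "(\<lambda>n. expectation (\<lambda>\<omega>. exp (- Y n \<omega>)) / exp (- real c)) \<longlonglongrightarrow> 0"
      using tendsto_divide[OF lim tendsto_const, of "exp (- real c)"] by simp
    ultimately have "prob ?S \<le> 0"
      by (intro LIMSEQ_le_const) blast+
    then have "?S \<in> null_sets M"
      using S by (simp add: emeasure_eq_measure null_sets_def measure_le_0_iff)
    from AE_not_in[OF this] AE_space show ?thesis
      by eventually_elim (auto simp: not_le)
  qed
  then have "AE \<omega> in M. \<forall>c::nat. \<exists>n. exp (- Y n \<omega>) < exp (- real c)"
    by (simp add: AE_all_countable)
  then show ?thesis
  proof eventually_elim
    case (elim \<omega>)
    show ?case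
    proof
      fix c :: real
      obtain m where "c < real m" using reals_Archimedean2 by blast
      moreover obtain n where "real m < Y n \<omega>" using elim by auto
      ultimately show "\<exists>n. c < Y n \<omega>" by (meson less_trans)
    qed
  qed
qed

lemma generalized_inverse_mono:
  fixes f :: "real \<Rightarrow> real"
  assumes unbounded: "\<And>t. \<exists>s>0. t < f s" and "t \<le> t'"
  shows "Inf {s. 0 < s \<and> t < f s} \<le> Inf {s. 0 < s \<and> t' < f s}"
proof (rule cInf_superset_mono)
  show "{s. 0 < s \<and> t' < f s} \<noteq> {}"
    using unbounded[of t'] by auto
  show "bdd_below {s. 0 < s \<and> t < f s}"
    by (rule bdd_belowI[of _ 0]) auto
qed (use assms(2) in auto)

text \<open>
  The inverse vanishes on the negative axis and takes every value \<open>s \<ge> 0\<close>, at the point \<open>f s\<close>.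
  Replacing it by the identity on the negative axis gives a monotone surjection of the whole line,
  which must be continuous, and whose positive part is the inverse.
\<close>

lemma generalized_inverse_continuous:
  fixes f :: "real \<Rightarrow> real"
  assumes mono: "strict_mono_on {0..} f" and f0: "f 0 = 0"
    and unbounded: "\<And>t. \<exists>s>0. t < f s"
  shows "continuous_on UNIV (\<lambda>t. Inf {s. 0 < s \<and> t < f s})"
proof -
  define e where "e = (\<lambda>t. Inf {s. 0 < s \<and> t < f s})"
  define g where "g = (\<lambda>t. if t < 0 then t else e t)"
  have pos: "0 < f s" if "0 < s" for s
    using strict_mono_onD[OF mono, of 0 s] that f0 by auto
  have e_nonneg: "0 \<le> e t" for t
    unfolding e_def using unbounded[of t] by (intro cInf_greatest) auto
  have e_neg: "e t = 0" if "t < 0" for t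
  proof -
    have "{s. 0 < s \<and> t < f s} = {0<..}"
      using pos that by (auto intro: less_trans)
    then show ?thesis by (simp add: e_def)
  qed
  have e_f: "e (f s) = s" if "0 \<le> s" for s
  proof -
    have "{r. 0 < r \<and> f s < f r} = {s<..}"
      using that strict_mono_on_less[OF mono, of s] by auto
    then show ?thesis by (simp add: e_def)
  qed
  have "s \<in> range g" for s
  proof (cases "s < 0")
    case True
    then have "g s = s" by (simp add: g_def)
    then show ?thesis by (metis rangeI)
  next
    case False
    then have "g (f s) = s"
      using pos[of s] f0 e_f[of s] by (cases "s = 0") (auto simp: g_def)
    then show ?thesis by (metis rangeI)
  qed
  then have "range g = UNIV" by auto
  moreover have "g t \<le> g t'" if "t \<le> t'" for t t'
    using generalized_inverse_mono[OF unbounded that] e_nonneg[of t'] that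
    by (auto simp: g_def e_def)
  ultimately have "continuous_on UNIV g"
    by (intro continuous_onI_mono) auto
  then have "continuous_on UNIV (\<lambda>t. max 0 (g t))"
    by (intro continuous_intros)
  moreover have "max 0 (g t) = e t" for t
    using e_neg[of t] e_nonneg[of t] by (auto simp: g_def)
  ultimately show ?thesis by (simp add: e_def)
qed

lemma interval_measure_atomless:
  fixes F :: "real \<Rightarrow> real"
  assumes "mono F" "continuous_on UNIV F"
  shows "emeasure (interval_measure F) {t} = 0"
  using emeasure_interval_measure_Icc[OF order_refl monoD[OF assms(1)] assms(2), of t] by simp

lemma (in prob_space) AE_path_measure_atomless:
  assumes U: "stable_subordinator M \<beta> U"
  shows "AE \<omega> in M. \<forall>t. emeasure (path_measure (inverse_subordinator U) \<omega>) {t} = 0"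
proof -
  have mono: "AE \<omega> in M. strict_mono_on {0..} (\<lambda>t. U t \<omega>)" and U0: "AE \<omega> in M. U 0 \<omega> = 0"
    using U by (auto simp: stable_subordinator_def stable_levy_process_def levy_process_def)
  have int: "integrable M (\<lambda>\<omega>. exp (- U (real n) \<omega>))"
    and Laplace: "expectation (\<lambda>\<omega>. exp (- U (real n) \<omega>)) = exp (- real n)" for n
  proof -
    have "\<forall>t\<ge>0. \<forall>s\<ge>0. integrable M (\<lambda>\<omega>. exp (- s * U t \<omega>)) \<and>
        expectation (\<lambda>\<omega>. exp (- s * U t \<omega>)) = exp (- t * s powr \<beta>)"
      using U by (simp add: stable_subordinator_def)
    from this[rule_format, of "real n" 1]
    have "integrable M (\<lambda>\<omega>. exp (- 1 * U (real n) \<omega>)) \<and>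
        expectation (\<lambda>\<omega>. exp (- 1 * U (real n) \<omega>)) = exp (- real n * 1 powr \<beta>)"
      by simp
    then show "integrable M (\<lambda>\<omega>. exp (- U (real n) \<omega>))"
      "expectation (\<lambda>\<omega>. exp (- U (real n) \<omega>)) = exp (- real n)" by simp_all
  qed
  have "(\<lambda>n. exp (- real n)) \<longlonglongrightarrow> 0"
    by (intro filterlim_compose[OF exp_at_bot] filterlim_compose[OF filterlim_uminus_at_bot_at_top]
        filterlim_real_sequentially)
  then have "AE \<omega> in M. \<forall>c. \<exists>n. c < U (real n) \<omega>"
    using AE_unbounded_if_Laplace_tendsto_0[of "\<lambda>n. U (real n)"] int by (simp add: Laplace)
  with mono U0 show ?thesis
  proof eventually_elim
    case (elim \<omega>)
    have unbounded: "\<exists>s>0. t < U s \<omega>" for t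
    proof -
      obtain n where n: "max 0 t < U (real n) \<omega>" using elim by blast
      \<comment> \<open>The index is positive because \<open>U 0 \<omega> = 0\<close>; the infimum ranges over positive times only.\<close>
      then have "n \<noteq> 0" using elim by (cases "n = 0") auto
      then show ?thesis using n by (intro exI[of _ "real n"]) auto
    qed
    have "mono (\<lambda>t. inverse_subordinator U t \<omega>)"
      unfolding inverse_subordinator_def
      by (rule monoI, rule generalized_inverse_mono[OF unbounded])
    moreover have "continuous_on UNIV (\<lambda>t. inverse_subordinator U t \<omega>)"
      unfolding inverse_subordinator_def
      by (rule generalized_inverse_continuous) (use elim unbounded in auto)
    ultimately show ?case
      unfolding path_measure_def by (simp add: interval_measure_atomless)
  qed
qed

section \<open>The stochastic Gronwall inequality\<close>

theorem lemma3p1: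
  fixes M :: "'a measure" and \<beta> T u0 :: real
    and U E B x K :: "real \<Rightarrow> 'a \<Rightarrow> real"
    and F :: "real \<Rightarrow> 'a measure"
  assumes "prob_space M"
    and "0 < \<beta>" and "\<beta> < 1"
    and "stable_subordinator M \<beta> U"
    and "E = inverse_subordinator U"
    and "standard_brownian_motion M B"
    and "F = time_changed_filtration (space M) B E"
    and "0 < T"
    and "\<And>t \<omega>. t \<in> {0..T} \<Longrightarrow> \<omega> \<in> space M \<Longrightarrow> 0 \<le> x t \<omega>"
    and "\<And>t \<omega>. t \<in> {0..T} \<Longrightarrow> \<omega> \<in> space M \<Longrightarrow> 0 \<le> K t \<omega>"
    and "adapted_upto F T x"
    and "adapted_upto F T K"
    and "AE \<omega> in M. set_integrable (path_measure E \<omega>) {0<..T} (\<lambda>s. x s \<omega>)"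
    and "AE \<omega> in M. set_integrable (path_measure E \<omega>) {0<..T} (\<lambda>s. K s \<omega>)"
    and "AE \<omega> in M. set_integrable (path_measure E \<omega>) {0<..T} (\<lambda>s. K s \<omega> * x s \<omega>)"
    and "0 \<le> u0"
    and "AE \<omega> in M. \<forall>t\<in>{0..T}.
           x t \<omega> \<le> u0 + (LINT s:{0<..t}|path_measure E \<omega>. K s \<omega> * x s \<omega>)"
  shows "AE \<omega> in M. \<forall>t\<in>{0..T}.
           x t \<omega> \<le> u0 * exp (LINT s:{0<..t}|path_measure E \<omega>. K s \<omega>)"
proof -
  interpret prob_space M by fact
  have atomless: "AE \<omega> in M. \<forall>t. emeasure (path_measure E \<omega>) {t} = 0"
    unfolding \<open>E = inverse_subordinator U\<close> using assms(4) by (rule AE_path_measure_atomless)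
  from atomless assms(14,15,17) AE_space show ?thesis
  proof eventually_elim
    case (elim \<omega>)
    have N: "sets (path_measure E \<omega>) = sets borel"
      by (simp add: path_measure_def)
    show ?case
    proof
      fix t assume t: "t \<in> {0..T}"
      show "x t \<omega> \<le> u0 * exp (LINT s:{0<..t}|path_measure E \<omega>. K s \<omega>)"
      proof (rule gronwall_atomless[OF N _ _ _ elim(2,3) _ t])
        show "emeasure (path_measure E \<omega>) {s} = 0" for s
          using elim(1) by blast
        show "0 \<le> K s \<omega>" "0 \<le> x s \<omega>" if "s \<in> {0..T}" for s
          using assms(9,10) that elim(5) by blast+
        show "x s \<omega> \<le> u0 + (LINT r:{0<..s}|path_measure E \<omega>. K r \<omega> * x r \<omega>)"
          if "s \<in> {0..T}" for s
          using elim(4) that by blast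
      qed
    qed
  qed
qed

end
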